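(* Let $S$ be a Garside family in a left-cancellative category $\mathcal{C}$, let $W$ be a $\square$-witness on $S^\sharp$, and let $E$ be an $=^\times$-test on $S^\sharp$. (i) Given two $S$-normal paths $u$ and $v$ of length at most $\ell$ (with the same source and the same target), the function CompareNormalPaths described in the context decides in time $O(\ell)$ whether $[u]=[v]$ holds. (ii) Given two $S^\sharp$-paths $u$ and $v$ of length at most $\ell$, the algorithm Word Problem I described in the context decides in time $O(\ell^2)$ whether $[u]=[v]$ holds.
   Context: Categories are viewed as monoids with a partial product: $fg$ is defined iff the target of $f$ is the source of $g$; $1_x$ is the identity at $x$. $\mathcal{C}$ is left-cancellative if $fg=fg'$ implies $g=g'$. $f\preccurlyeq g$ means $fg'=g$ for some $g'\in\mathcal{C}$. $\mathcal{C}^\times$ is the family of invertible elements; $f=^\times g$ means $fe=g$ for some $e\in\mathcal{C}^\times$. For $S\subseteq\mathcal{C}$, $S^\sharp=S\mathcal{C}^\times\cup\mathcal{C}^\times$. For a path $w=g_1|\cdots|g_p$ (finite sequence of composable elements; empty paths $\varepsilon_x$ allowed), $[w]=g_1\cdots g_p$ is the element it represents. The path is $S$-greedy if, for every $i<p$, all $a\in S$, $f\in\mathcal{C}$, $a\preccurlyeq fg_ig_{i+1}$ implies $a\preccurlyeq fg_i$; it is $S$-normal if moreover all entries lie in $S^\sharp$. $S$ is a Garside family if every element of $\mathcal{C}$ is represented by an $S$-normal path. A $\square$-witness on $A\subseteq\mathcal{C}$ is a map $W$ assigning to every composable pair $(a_1,a_2)$ in $A$ a pair $(b_1,b_2)$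 in $A$ with $b_1b_2=a_1a_2$ and $b_1|b_2$ $A$-greedy. An $=^\times$-test on $A$ is a map $E:A^2\to\mathcal{C}^\times\cup\{\bot\}$ such that $aE(a,b)=b$ if $a=^\times b$, and $E(a,b)=\bot$ otherwise. Running time counts evaluations of $W$, $E$, products and comparisons of entries as unit cost. Normal Decomposition (input $b_1|\cdots|b_p$ with $b_i\in S^\sharp$): put $b_{0,i}:=b_i$; for $j$ decreasing from $p$ to $1$: for $i=1,\dots,p-j$ put $(a_{i,j-1},b_{i,j}):=W(b_{i-1,j},a_{i,j})$, then $a_{p-j+1,j-1}:=b_{p-j,j}$; return $a_{1,0}|\cdots|a_{p,0}$. CompareNormalPaths (input $a_1|\cdots|a_p$ and $b_1|\cdots|b_q$ with common source $x$ and common target $y$): put $r=\max(p,q)$, $e_0:=1_x$, $b_i:=1_y$ for $q<i\le r$, $a_i:=1_y$ for $p<i\le r$. For $i=1,\dots,r$: if $E(b_i,e_{i-1}a_i)\neq\bot$, put $e_i:=E(b_i,e_{i-1}a_i)$; otherwise return false. At the end return true if $e_r=1_y$, and false otherwise. Word Problem I (input $u,v$): if the sources or the targets of $u$ and $v$ differ, return false. Otherwise apply Normal Decomposition to $u$ and to $v$ and return the value of CompareNormalPaths on the two resulting $S$-normal paths. *)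

theory Defs
  imports Complex_Main "HOL-Library.Landau_Symbols"
begin

section \<open>Left-cancellative categories\<close>

text \<open>
  Products are written in diagrammatic order. The field \<open>cprod\<close> is a total HOL function
  whose value \<open>f \<cdot> g\<close> is meaningful only if \<open>tgt f = src g\<close>; every definition below guards its
  products accordingly.
\<close>

record ('o, 'm) cat =
  Ob :: "'o set"
  Mor :: "'m set"
  src :: "'m \<Rightarrow> 'o"
  tgt :: "'m \<Rightarrow> 'o"
  ident :: "'o \<Rightarrow> 'm"  ("\<one>\<index>")
  cprod :: "'m \<Rightarrow> 'm \<Rightarrow> 'm"  (infixl "\<cdot>\<index>" 70)

locale left_cancellative_category =
  fixes C :: "('o, 'm) cat" (structure)
  assumes src_closed: "f \<in> Mor C \<Longrightarrow> src C f \<in> Ob C"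
    and tgt_closed: "f \<in> Mor C \<Longrightarrow> tgt C f \<in> Ob C"
    and ident_closed: "x \<in> Ob C \<Longrightarrow> \<one> x \<in> Mor C"
    and src_ident: "x \<in> Ob C \<Longrightarrow> src C (\<one> x) = x"
    and tgt_ident: "x \<in> Ob C \<Longrightarrow> tgt C (\<one> x) = x"
    and cprod_closed: "\<lbrakk>f \<in> Mor C; g \<in> Mor C; tgt C f = src C g\<rbrakk> \<Longrightarrow> f \<cdot> g \<in> Mor C"
    and src_cprod: "\<lbrakk>f \<in> Mor C; g \<in> Mor C; tgt C f = src C g\<rbrakk> \<Longrightarrow> src C (f \<cdot> g) = src C f"
    and tgt_cprod: "\<lbrakk>f \<in> Mor C; g \<in> Mor C; tgt C f = src C g\<rbrakk> \<Longrightarrow> tgt C (f \<cdot> g) = tgt C g"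
    and left_unit: "f \<in> Mor C \<Longrightarrow> \<one> (src C f) \<cdot> f = f"
    and right_unit: "f \<in> Mor C \<Longrightarrow> f \<cdot> \<one> (tgt C f) = f"
    and assoc: "\<lbrakk>f \<in> Mor C; g \<in> Mor C; h \<in> Mor C; tgt C f = src C g; tgt C g = src C h\<rbrakk>
      \<Longrightarrow> (f \<cdot> g) \<cdot> h = f \<cdot> (g \<cdot> h)"
    and left_cancel: "\<lbrakk>f \<in> Mor C; g \<in> Mor C; g' \<in> Mor C; tgt C f = src C g; tgt C f = src C g';
        f \<cdot> g = f \<cdot> g'\<rbrakk> \<Longrightarrow> g = g'"

definition left_divides :: "('o, 'm) cat \<Rightarrow> 'm \<Rightarrow> 'm \<Rightarrow> bool" where
  "left_divides C f g \<longleftrightarrow> f \<in> Mor C \<and> (\<exists>f' \<in> Mor C. tgt C f = src C f' \<and> f \<cdot>\<^bsub>C\<^esub> f' = g)"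

definition invertibles :: "('o, 'm) cat \<Rightarrow> 'm set" where
  "invertibles C = {e \<in> Mor C. \<exists>e' \<in> Mor C. src C e' = tgt C e \<and> tgt C e' = src C e \<and>
     e \<cdot>\<^bsub>C\<^esub> e' = \<one>\<^bsub>C\<^esub> (src C e) \<and> e' \<cdot>\<^bsub>C\<^esub> e = \<one>\<^bsub>C\<^esub> (tgt C e)}"

text \<open>The relation \<open>f =\<^sup>\<times> g\<close>.\<close>

definition eq_unit :: "('o, 'm) cat \<Rightarrow> 'm \<Rightarrow> 'm \<Rightarrow> bool" where
  "eq_unit C f g \<longleftrightarrow> f \<in> Mor C \<and> (\<exists>e \<in> invertibles C. tgt C f = src C e \<and> f \<cdot>\<^bsub>C\<^esub> e = g)"

definition sharp :: "('o, 'm) cat \<Rightarrow> 'm set \<Rightarrow> 'm set" where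
  "sharp C S = {s \<cdot>\<^bsub>C\<^esub> e | s e. s \<in> S \<and> e \<in> invertibles C \<and> tgt C s = src C e} \<union> invertibles C"


section \<open>Paths and Garside families\<close>

text \<open>
  A path is stored as its source together with the list of its entries, so that there is one empty
  path \<open>(x, [])\<close> for each object \<open>x\<close>.
\<close>

type_synonym ('o, 'm) path = "'o \<times> 'm list"

abbreviation path_src :: "('o, 'm) path \<Rightarrow> 'o" where
  "path_src \<equiv> fst"

abbreviation entries :: "('o, 'm) path \<Rightarrow> 'm list" where
  "entries \<equiv> snd"

abbreviation path_length :: "('o, 'm) path \<Rightarrow> nat" where
  "path_length w \<equiv> length (entries w)"

definition path_tgt :: "('o, 'm) cat \<Rightarrow> ('o, 'm) path \<Rightarrow> 'o" where
  "path_tgt C w = (if entries w = [] then path_src w else tgt C (last (entries w)))"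

fun composable_from :: "('o, 'm) cat \<Rightarrow> 'o \<Rightarrow> 'm list \<Rightarrow> bool" where
  "composable_from C x [] \<longleftrightarrow> x \<in> Ob C"
| "composable_from C x (g # gs) \<longleftrightarrow> g \<in> Mor C \<and> src C g = x \<and> composable_from C (tgt C g) gs"

definition is_path :: "('o, 'm) cat \<Rightarrow> 'm set \<Rightarrow> ('o, 'm) path \<Rightarrow> bool" where
  "is_path C A w \<longleftrightarrow> composable_from C (path_src w) (entries w) \<and> set (entries w) \<subseteq> A"

fun prod_from :: "('o, 'm) cat \<Rightarrow> 'o \<Rightarrow> 'm list \<Rightarrow> 'm" where
  "prod_from C x [] = \<one>\<^bsub>C\<^esub> x"
| "prod_from C x (g # gs) = g \<cdot>\<^bsub>C\<^esub> prod_from C (tgt C g) gs"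

definition path_value :: "('o, 'm) cat \<Rightarrow> ('o, 'm) path \<Rightarrow> 'm" where
  "path_value C w = prod_from C (path_src w) (entries w)"

definition greedy :: "('o, 'm) cat \<Rightarrow> 'm set \<Rightarrow> ('o, 'm) path \<Rightarrow> bool" where
  "greedy C A w \<longleftrightarrow> is_path C (Mor C) w \<and>
     (\<forall>i. Suc i < path_length w \<longrightarrow>
       (\<forall>a \<in> A. \<forall>f \<in> Mor C. tgt C f = src C (entries w ! i) \<longrightarrow>
         left_divides C a (f \<cdot>\<^bsub>C\<^esub> entries w ! i \<cdot>\<^bsub>C\<^esub> entries w ! Suc i) \<longrightarrow>
         left_divides C a (f \<cdot>\<^bsub>C\<^esub> entries w ! i)))"

definition normal :: "('o, 'm) cat \<Rightarrow> 'm set \<Rightarrow> ('o, 'm) path \<Rightarrow> bool" where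
  "normal C S w \<longleftrightarrow> is_path C (sharp C S) w \<and> greedy C S w"

definition garside_family :: "('o, 'm) cat \<Rightarrow> 'm set \<Rightarrow> bool" where
  "garside_family C S \<longleftrightarrow> S \<subseteq> Mor C \<and> (\<forall>g \<in> Mor C. \<exists>w. normal C S w \<and> path_value C w = g)"


section \<open>Witnesses and tests\<close>

text \<open>
  Both are total HOL functions, constrained only on their intended domain (composable pairs in \<open>A\<close>,
  respectively \<open>A \<times> A\<close>). The value \<open>None\<close> plays the role of \<open>\<bottom>\<close>.
\<close>

definition square_witness ::
  "('o, 'm) cat \<Rightarrow> 'm set \<Rightarrow> ('m \<times> 'm \<Rightarrow> 'm \<times> 'm) \<Rightarrow> bool" where
  "square_witness C A W \<longleftrightarrow>
     (\<forall>a\<^sub>1 \<in> A. \<forall>a\<^sub>2 \<in> A. tgt C a\<^sub>1 = src C a\<^sub>2 \<longrightarrow>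
       (case W (a\<^sub>1, a\<^sub>2) of (b\<^sub>1, b\<^sub>2) \<Rightarrow>
         b\<^sub>1 \<in> A \<and> b\<^sub>2 \<in> A \<and> tgt C b\<^sub>1 = src C b\<^sub>2 \<and> b\<^sub>1 \<cdot>\<^bsub>C\<^esub> b\<^sub>2 = a\<^sub>1 \<cdot>\<^bsub>C\<^esub> a\<^sub>2 \<and>
         greedy C A (src C b\<^sub>1, [b\<^sub>1, b\<^sub>2])))"

definition eq_unit_test ::
  "('o, 'm) cat \<Rightarrow> 'm set \<Rightarrow> ('m \<times> 'm \<Rightarrow> 'm option) \<Rightarrow> bool" where
  "eq_unit_test C A E \<longleftrightarrow>
     (\<forall>a \<in> A. \<forall>b \<in> A.
       if eq_unit C a b
       then \<exists>e \<in> invertibles C. E (a, b) = Some e \<and> tgt C a = src C e \<and> a \<cdot>\<^bsub>C\<^esub> e = b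
       else E (a, b) = None)"


section \<open>The algorithms\<close>

text \<open>
  Algorithms return their result together with the number of unit-cost steps performed. The
  unit-cost steps, marked by \<open>step\<close>, are the evaluations of \<open>W\<close> and \<open>E\<close>, the products in the
  category, and the comparisons.
\<close>

type_synonym 'r timed = "'r \<times> nat"

abbreviation result :: "'r timed \<Rightarrow> 'r" where
  "result \<equiv> fst"

abbreviation cost :: "'r timed \<Rightarrow> nat" where
  "cost \<equiv> snd"

definition return :: "'r \<Rightarrow> 'r timed" where
  "return r = (r, 0)"

definition step :: "'r \<Rightarrow> 'r timed" where
  "step r = (r, 1)"

definition bind_timed :: "'q timed \<Rightarrow> ('q \<Rightarrow> 'r timed) \<Rightarrow> 'r timed" (infixl "\<bind>" 54) where
  "m \<bind> k = (result (k (result m)), cost m + cost (k (result m)))"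

text \<open>
  One round \<open>j\<close> of the outer loop of Normal Decomposition. It is called with \<open>b = b\<^bsub>0,j\<^esub>\<close> and the list
  \<open>a\<^bsub>1,j\<^esub>, \<dots>, a\<^bsub>p-j,j\<^esub>\<close>, and returns \<open>a\<^bsub>1,j-1\<^esub>, \<dots>, a\<^bsub>p-j+1,j-1\<^esub>\<close>; the recursion is the inner loop over \<open>i\<close>,
  with \<open>b\<close> and \<open>a\<close> in the second equation standing for \<open>b\<^bsub>i-1,j\<^esub>\<close> and \<open>a\<^bsub>i,j\<^esub>\<close>.
\<close>

fun normal_decomp_round :: "('m \<times> 'm \<Rightarrow> 'm \<times> 'm) \<Rightarrow> 'm \<Rightarrow> 'm list \<Rightarrow> 'm list timed" where
  "normal_decomp_round W b [] = return [b]"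
| "normal_decomp_round W b (a # as) =
     step (W (b, a)) \<bind> (\<lambda>(a', b').
     normal_decomp_round W b' as \<bind> (\<lambda>as'.
     return (a' # as')))"

text \<open>
  The outer loop runs over decreasing \<open>j\<close>, that is, over the entries of the input from right to left.
\<close>

fun normal_decomp_list :: "('m \<times> 'm \<Rightarrow> 'm \<times> 'm) \<Rightarrow> 'm list \<Rightarrow> 'm list timed" where
  "normal_decomp_list W [] = return []"
| "normal_decomp_list W (b # bs) =
     normal_decomp_list W bs \<bind> (\<lambda>as. normal_decomp_round W b as)"

definition normal_decomposition ::
  "('m \<times> 'm \<Rightarrow> 'm \<times> 'm) \<Rightarrow> ('o, 'm) path \<Rightarrow> ('o, 'm) path timed" where
  "normal_decomposition W w =
     normal_decomp_list W (entries w) \<bind> (\<lambda>as. return (path_src w, as))"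

text \<open>
  The main loop of CompareNormalPaths, on the two padded lists; \<open>e\<close> stands for \<open>e\<^bsub>i-1\<^esub>\<close>. The lists
  always have the same length, so the second equation is only reached with both lists empty.
\<close>

fun compare_loop ::
  "('o, 'm) cat \<Rightarrow> ('m \<times> 'm \<Rightarrow> 'm option) \<Rightarrow> 'o \<Rightarrow> 'm \<Rightarrow> 'm list \<Rightarrow> 'm list \<Rightarrow> bool timed" where
  "compare_loop C E y e (a # as) (b # bs) =
     step (e \<cdot>\<^bsub>C\<^esub> a) \<bind> (\<lambda>c.
     step (E (b, c)) \<bind> (\<lambda>t.
     case t of None \<Rightarrow> return False | Some e' \<Rightarrow> compare_loop C E y e' as bs))"
| "compare_loop C E y e _ _ = step (e = \<one>\<^bsub>C\<^esub> y)"

definition compare_normal_paths ::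
  "('o, 'm) cat \<Rightarrow> ('m \<times> 'm \<Rightarrow> 'm option) \<Rightarrow> ('o, 'm) path \<Rightarrow> ('o, 'm) path \<Rightarrow> bool timed" where
  "compare_normal_paths C E u v =
     (let x = path_src u; y = path_tgt C u;
          p = path_length u; q = path_length v; r = max p q;
          as = entries u @ replicate (r - p) (\<one>\<^bsub>C\<^esub> y);
          bs = entries v @ replicate (r - q) (\<one>\<^bsub>C\<^esub> y)
      in compare_loop C E y (\<one>\<^bsub>C\<^esub> x) as bs)"

definition word_problem_I ::
  "('o, 'm) cat \<Rightarrow> ('m \<times> 'm \<Rightarrow> 'm \<times> 'm) \<Rightarrow> ('m \<times> 'm \<Rightarrow> 'm option) \<Rightarrow>
   ('o, 'm) path \<Rightarrow> ('o, 'm) path \<Rightarrow> bool timed" where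
  "word_problem_I C W E u v =
     step (path_src u \<noteq> path_src v) \<bind> (\<lambda>src_differ.
     step (path_tgt C u \<noteq> path_tgt C v) \<bind> (\<lambda>tgt_differ.
     if src_differ \<or> tgt_differ then return False
     else
       normal_decomposition W u \<bind> (\<lambda>u'.
       normal_decomposition W v \<bind> (\<lambda>v'.
       compare_normal_paths C E u' v'))))"

end

theory Submission
  imports Defs
begin

text \<open>
  An $S$-normal path is determined by its value up to invertible elements and padding by
  identities. Greediness of \<open>g\<^sub>1|\<dots>|g\<^sub>p\<close> propagates along the path, so that an element of $S^\sharp$ that left-divides
  \<open>g\<^sub>1\<cdots>g\<^sub>p\<close> already left-divides \<open>g\<^sub>1\<close> (\<open>greedy_head\<close>). Hence the first entries of two normal
  paths with the same value divide each other, and in a left-cancellative category this means that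
  they differ by an invertible right factor (\<open>normal_head_unique\<close>).

  The comparison loop maintains an invertible \<open>e\<close> such that the two input paths have the same value
  iff \<open>e\<close> times the rest of the first one is the rest of the second one. Moving \<open>e\<close> into the
  first remaining entry keeps the path normal, because $S^\sharp$ is closed under left
  multiplication by invertible elements (\<open>sharp_left_mult\<close>, where the existence of
  normal decompositions enters). So, if the values agree, the first entries differ by an
  invertible element, which the test finds and which is the next \<open>e\<close>; if the test fails, the
  values differ. When both lists are used up, the question has become whether \<open>e\<close> is an
  identity. Padding keeps the paths normal, since an identity can be appended to any greedy path.

  For the general word problem it remains to see that Normal Decomposition produces a normal path
  with the same value. This follows from a domino rule: if the path \<open>a|as\<close> is greedy, if
  \<open>b \<cdot> a = a' \<cdot> b'\<close> with \<open>a'|b'\<close> greedy, and if \<open>c\<close> left-divides \<open>b' \<cdot> [as]\<close>, then \<open>a'|c\<close> is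
  greedy (\<open>domino\<close>).

  For the running times, the comparison makes at most two steps for each entry of the padded
  lists and one at the end, and the round that treats an entry of the input evaluates the witness
  once for each entry to its right.
\<close>

section \<open>Divisibility and greediness\<close>

text \<open>
  The condition on two adjacent entries is isolated in order to make greediness recursive in the
  list of entries.
\<close>

definition greedy_pair :: "('o, 'm) cat \<Rightarrow> 'm set \<Rightarrow> 'm \<Rightarrow> 'm \<Rightarrow> bool" where
  "greedy_pair C A g h \<longleftrightarrow>
     (\<forall>a \<in> A. \<forall>f \<in> Mor C. tgt C f = src C g \<longrightarrow>
        left_divides C a (f \<cdot>\<^bsub>C\<^esub> g \<cdot>\<^bsub>C\<^esub> h) \<longrightarrow> left_divides C a (f \<cdot>\<^bsub>C\<^esub> g))"

lemma is_path_Nil [simp]: "is_path C A (x, []) \<longleftrightarrow> x \<in> Ob C"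
  by (simp add: is_path_def)

lemma is_path_Cons [simp]:
  "is_path C A (x, g # gs) \<longleftrightarrow> g \<in> A \<and> g \<in> Mor C \<and> src C g = x \<and> is_path C A (tgt C g, gs)"
  by (auto simp: is_path_def)

lemma path_tgt_Nil [simp]: "path_tgt C (x, []) = x"
  by (simp add: path_tgt_def)

lemma path_tgt_Cons [simp]: "path_tgt C (x, g # gs) = path_tgt C (tgt C g, gs)"
  by (simp add: path_tgt_def)

lemma greedy_Nil [simp]: "greedy C A (x, []) \<longleftrightarrow> x \<in> Ob C"
  by (simp add: greedy_def)

lemma greedy_Cons:
  "greedy C A (x, g # gs) \<longleftrightarrow>
     g \<in> Mor C \<and> src C g = x \<and> greedy C A (tgt C g, gs) \<and> (gs \<noteq> [] \<longrightarrow> greedy_pair C A g (hd gs))"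
proof (cases gs)
  case Nil
  then show ?thesis by (auto simp: greedy_def)
next
  case (Cons h hs)
  have all_Suc: "(\<forall>i. Suc i < Suc (Suc n) \<longrightarrow> P i) \<longleftrightarrow> P 0 \<and> (\<forall>i. Suc i < Suc n \<longrightarrow> P (Suc i))"
    for n and P :: "nat \<Rightarrow> bool"
    by (metis Suc_less_eq less_Suc_eq_0_disj zero_less_Suc)
  show ?thesis
    unfolding greedy_def Cons greedy_pair_def snd_conv list.size(4) add_0_right add_Suc_right
      One_nat_def all_Suc
    by auto
qed

context left_cancellative_category
begin

lemmas cat_simps [simp] =
  src_closed tgt_closed ident_closed src_ident tgt_ident cprod_closed src_cprod tgt_cprod

lemma invertibleE:
  assumes "e \<in> invertibles C"
  obtains e' where "e \<in> Mor C" "e' \<in> Mor C" "e' \<in> invertibles C" "src C e' = tgt C e"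
    "tgt C e' = src C e" "e \<cdot> e' = \<one> (src C e)" "e' \<cdot> e = \<one> (tgt C e)"
  using assms by (force simp: invertibles_def)

lemma invertible_Mor: "e \<in> invertibles C \<Longrightarrow> e \<in> Mor C"
  by (simp add: invertibles_def)

lemma ident_invertible: "x \<in> Ob C \<Longrightarrow> \<one> x \<in> invertibles C"
  using left_unit[of "\<one> x"] by (force simp: invertibles_def)

lemma invertible_cancel_left:
  assumes "e \<in> Mor C" "e' \<in> Mor C" "src C e' = tgt C e" "e' \<cdot> e = \<one> (tgt C e)"
    and "g \<in> Mor C" "tgt C e = src C g" "tgt C e' = src C e"
  shows "e' \<cdot> (e \<cdot> g) = g"
  using assms assoc[of e' e g] left_unit[of g] by simp

lemma invertible_mult:
  assumes "d \<in> invertibles C" "e \<in> invertibles C" "tgt C d = src C e"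
  shows "d \<cdot> e \<in> invertibles C"
proof -
  obtain d' where d: "d \<in> Mor C" "d' \<in> Mor C" "src C d' = tgt C d" "tgt C d' = src C d"
    "d \<cdot> d' = \<one> (src C d)" "d' \<cdot> d = \<one> (tgt C d)" using assms(1) by (rule invertibleE)
  obtain e' where e: "e \<in> Mor C" "e' \<in> Mor C" "src C e' = tgt C e" "tgt C e' = src C e"
    "e \<cdot> e' = \<one> (src C e)" "e' \<cdot> e = \<one> (tgt C e)" using assms(2) by (rule invertibleE)
  have "e \<cdot> (e' \<cdot> d') = d'"
    using d e assms(3) invertible_cancel_left[of e' e d'] by simp
  then have "(d \<cdot> e) \<cdot> (e' \<cdot> d') = \<one> (src C d)"
    using d e assms(3) by (simp add: assoc)
  moreover have "d' \<cdot> (d \<cdot> e) = e"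
    using d e assms(3) invertible_cancel_left[of d d' e] by simp
  then have "(e' \<cdot> d') \<cdot> (d \<cdot> e) = \<one> (tgt C e)"
    using d e assms(3) by (simp add: assoc)
  ultimately show ?thesis
    using d e assms(3) unfolding invertibles_def by (force intro!: bexI[of _ "e' \<cdot> d'"])
qed

text \<open>
  Cancelling \<open>t\<close> in \<open>t \<cdot> (g \<cdot> t) = t\<close> turns a right inverse into a two-sided one.
\<close>

lemma right_inverse_invertible:
  assumes "t \<in> Mor C" "g \<in> Mor C" "tgt C t = src C g" "t \<cdot> g = \<one> (src C t)"
  shows "t \<in> invertibles C"
proof -
  have tg: "tgt C g = src C t"
    using assms tgt_cprod[of t g] by simp
  have "t \<cdot> (g \<cdot> t) = (t \<cdot> g) \<cdot> t"
    using assms(1-3) tg by (simp add: assoc)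
  also have "\<dots> = t \<cdot> \<one> (tgt C t)"
    using assms(1) by (simp add: assms(4) left_unit right_unit)
  finally have "t \<cdot> (g \<cdot> t) = t \<cdot> \<one> (tgt C t)" .
  then have "g \<cdot> t = \<one> (tgt C t)"
    using assms tg by - (rule left_cancel[of t], auto)
  then show ?thesis
    using assms tg by (auto simp: invertibles_def)
qed

lemma left_divides_mult:
  assumes "left_divides C a g" "g \<in> Mor C" "h \<in> Mor C" "tgt C g = src C h"
  shows "left_divides C a (g \<cdot> h)"
proof -
  obtain f where f: "a \<in> Mor C" "f \<in> Mor C" "tgt C a = src C f" "a \<cdot> f = g"
    using assms(1) by (auto simp: left_divides_def)
  then have "a \<cdot> (f \<cdot> h) = g \<cdot> h" "tgt C f = src C h"
    using assms by (auto simp: assoc[symmetric])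
  then show ?thesis
    using f assms by (auto simp: left_divides_def intro!: bexI[of _ "f \<cdot> h"])
qed

lemma left_divides_multI:
  "a \<in> Mor C \<Longrightarrow> g \<in> Mor C \<Longrightarrow> tgt C a = src C g \<Longrightarrow> left_divides C a (a \<cdot> g)"
  by (auto simp: left_divides_def)

lemma left_divides_src:
  "left_divides C a g \<Longrightarrow> src C a = src C g"
  by (auto simp: left_divides_def)

lemma invertible_left_divides:
  assumes "e \<in> invertibles C" "g \<in> Mor C" "src C e = src C g"
  shows "left_divides C e g"
proof -
  obtain e' where e: "e \<in> Mor C" "e' \<in> Mor C" "src C e' = tgt C e" "tgt C e' = src C e"
    "e \<cdot> e' = \<one> (src C e)" using assms(1) by (rule invertibleE)
  then have "e \<cdot> (e' \<cdot> g) = g"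
    using invertible_cancel_left[of e' e g] assms by simp
  then show ?thesis
    using e assms by (auto simp: left_divides_def intro!: bexI[of _ "e' \<cdot> g"])
qed

lemma left_divides_mult_invertible_iff:
  assumes "s \<in> Mor C" "e \<in> invertibles C" "tgt C s = src C e"
  shows "left_divides C (s \<cdot> e) g \<longleftrightarrow> left_divides C s g"
proof
  assume "left_divides C (s \<cdot> e) g"
  then obtain f where "f \<in> Mor C" "tgt C e = src C f" "(s \<cdot> e) \<cdot> f = g"
    using assms invertible_Mor by (auto simp: left_divides_def)
  then show "left_divides C s g"
    using assms invertible_Mor[OF assms(2)] by (auto simp: assoc intro!: left_divides_multI)
next
  assume "left_divides C s g"
  then obtain f where f: "f \<in> Mor C" "tgt C s = src C f" "s \<cdot> f = g"
    by (auto simp: left_divides_def)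
  have "left_divides C e f"
    using assms f by (simp add: invertible_left_divides)
  then obtain h where "h \<in> Mor C" "tgt C e = src C h" "e \<cdot> h = f"
    by (auto simp: left_divides_def)
  then show "left_divides C (s \<cdot> e) g"
    using assms invertible_Mor[OF assms(2)] f
    by (auto simp: left_divides_def assoc intro!: bexI[of _ h])
qed

lemma left_divides_antisym:
  assumes "left_divides C a b" "left_divides C b a"
  shows "eq_unit C a b"
proof -
  obtain f g where fg: "a \<in> Mor C" "b \<in> Mor C" "f \<in> Mor C" "g \<in> Mor C"
    "tgt C a = src C f" "tgt C b = src C g" "a \<cdot> f = b" "b \<cdot> g = a"
    using assms by (auto simp: left_divides_def)
  then have tf: "tgt C f = src C g" and tg: "tgt C g = tgt C a"
    by (metis tgt_cprod, metis tgt_cprod)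
  have "a \<cdot> (f \<cdot> g) = (a \<cdot> f) \<cdot> g"
    using fg(1-6) tf by (simp add: assoc)
  also have "\<dots> = a \<cdot> \<one> (tgt C a)"
    using fg(1) by (simp only: fg(7,8) right_unit)
  finally have "a \<cdot> (f \<cdot> g) = a \<cdot> \<one> (tgt C a)" .
  then have "f \<cdot> g = \<one> (src C f)"
    using fg(1-6) tf tg by - (rule left_cancel[of a], auto)
  then have "f \<in> invertibles C"
    using fg(1-6) tf by - (rule right_inverse_invertible[of f g], auto)
  then show ?thesis
    using fg(1,5,7) by (auto simp: eq_unit_def)
qed

lemma prod_from_closed:
  assumes "is_path C A (x, gs)"
  shows "prod_from C x gs \<in> Mor C \<and> src C (prod_from C x gs) = x
    \<and> tgt C (prod_from C x gs) = path_tgt C (x, gs)"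
  using assms by (induction gs arbitrary: x) auto

lemmas prod_from_simps =
  prod_from_closed[THEN conjunct1] prod_from_closed[THEN conjunct2, THEN conjunct1]
  prod_from_closed[THEN conjunct2, THEN conjunct2]

lemma greedy_is_path: "greedy C A w \<Longrightarrow> is_path C (Mor C) w"
  by (simp add: greedy_def)

lemma greedy_pairD:
  assumes "greedy_pair C A g h" "a \<in> A" "f \<in> Mor C" "tgt C f = src C g"
    and "left_divides C a (f \<cdot> g \<cdot> h)"
  shows "left_divides C a (f \<cdot> g)"
  using assms by (auto simp: greedy_pair_def)

text \<open>
  Greediness is a condition on adjacent entries. Arbitrary left factors \<open>f\<close> in it are what lets
  the argument peel off the last entries one by one: the earlier ones are absorbed into \<open>f\<close>.
\<close>

lemma greedy_head:
  assumes "greedy C A (x, g # gs)" "a \<in> A" "f \<in> Mor C" "tgt C f = x"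
    and "left_divides C a (f \<cdot> prod_from C x (g # gs))"
  shows "left_divides C a (f \<cdot> g)"
  using assms
proof (induction gs arbitrary: x f g)
  case Nil
  then show ?case by (auto simp: greedy_Cons right_unit)
next
  case (Cons h hs)
  have g: "g \<in> Mor C" "src C g = x" and rest: "greedy C A (tgt C g, h # hs)"
    and pair: "greedy_pair C A g h"
    using Cons.prems by (auto simp: greedy_Cons)
  note P = prod_from_simps[OF greedy_is_path[OF rest]]
  have "f \<cdot> prod_from C x (g # h # hs) = (f \<cdot> g) \<cdot> prod_from C (tgt C g) (h # hs)"
    using g P Cons.prems by (simp add: assoc)
  then have "left_divides C a (f \<cdot> g \<cdot> h)"
    using Cons.IH[OF rest, of "f \<cdot> g"] Cons.prems g by simp
  then show ?case
    using pair Cons.prems g by (auto intro: greedy_pairD)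
qed

lemma greedy_pair_ident:
  assumes "g \<in> Mor C" "tgt C g = y"
  shows "greedy_pair C A g (\<one> y)"
proof -
  have "f \<cdot> g \<cdot> \<one> y = f \<cdot> g" if "f \<in> Mor C" "tgt C f = src C g" for f
    using assms that right_unit[of "f \<cdot> g"] by simp
  then show ?thesis by (simp add: greedy_pair_def)
qed

lemma greedy_pair_mult_left:
  assumes "greedy_pair C A g h" "e \<in> Mor C" "tgt C e = src C g"
    and "g \<in> Mor C" "h \<in> Mor C" "tgt C g = src C h"
  shows "greedy_pair C A (e \<cdot> g) h"
  unfolding greedy_pair_def
proof (intro ballI impI)
  fix a f assume f: "a \<in> A" "f \<in> Mor C" "tgt C f = src C (e \<cdot> g)"
    and "left_divides C a (f \<cdot> (e \<cdot> g) \<cdot> h)"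
  moreover have eq: "f \<cdot> (e \<cdot> g) = (f \<cdot> e) \<cdot> g"
    using f assms by (simp add: assoc)
  ultimately show "left_divides C a (f \<cdot> (e \<cdot> g))"
    using assms greedy_pairD[of A g h a "f \<cdot> e"] by simp
qed

text \<open>
  If \<open>s\<close> divides \<open>f \<cdot> a' \<cdot> c\<close>, it also divides \<open>f \<cdot> a' \<cdot> b' \<cdot> [as] = f \<cdot> b \<cdot> a \<cdot> [as]\<close>,
  a right multiple. There, greediness of \<open>a|as\<close> removes \<open>as\<close>, and greediness of
  \<open>a'|b'\<close> removes \<open>b'\<close>.
\<close>

lemma domino:
  assumes greedy: "greedy C A (tgt C b, a # as)"
    and pair: "greedy_pair C A a' b'"
    and square: "b \<cdot> a = a' \<cdot> b'"
    and mor: "b \<in> Mor C" "a' \<in> Mor C" "b' \<in> Mor C" "tgt C a' = src C b'"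
    and c: "left_divides C c (b' \<cdot> prod_from C (tgt C a) as)"
  shows "greedy_pair C A a' c"
  unfolding greedy_pair_def
proof (intro ballI impI)
  fix s f assume s: "s \<in> A" and f: "f \<in> Mor C" "tgt C f = src C a'"
    and div: "left_divides C s (f \<cdot> a' \<cdot> c)"
  let ?P = "prod_from C (tgt C a) as"
  have a: "a \<in> Mor C" "src C a = tgt C b" and as: "is_path C (Mor C) (tgt C a, as)"
    using greedy_is_path[OF greedy] by auto
  note P = prod_from_simps[OF as]
  have ends: "src C a' = src C b" "tgt C b' = tgt C a"
    using square a mor by (metis src_cprod, metis tgt_cprod)
  obtain d where d: "c \<in> Mor C" "d \<in> Mor C" "tgt C c = src C d" "c \<cdot> d = b' \<cdot> ?P"
    using c by (auto simp: left_divides_def)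
  have src_c: "src C c = src C b'"
    using d(4) mor P ends by (metis d(1-3) src_cprod)
  have "(f \<cdot> a' \<cdot> c) \<cdot> d = f \<cdot> (a' \<cdot> (b' \<cdot> ?P))"
    using f mor d src_c by (simp add: assoc)
  also have "a' \<cdot> (b' \<cdot> ?P) = (b \<cdot> a) \<cdot> ?P"
    using mor P ends square by (simp add: assoc)
  also have "f \<cdot> ((b \<cdot> a) \<cdot> ?P) = (f \<cdot> b) \<cdot> prod_from C (tgt C b) (a # as)"
    using f mor P ends a by (simp add: assoc)
  finally have "left_divides C s ((f \<cdot> b) \<cdot> prod_from C (tgt C b) (a # as))"
    using left_divides_mult[OF div, of d] f mor d src_c by simp
  then have "left_divides C s (f \<cdot> b \<cdot> a)"
    using greedy_head[OF greedy s, of "f \<cdot> b"] f mor ends by simp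
  also have "f \<cdot> b \<cdot> a = f \<cdot> a' \<cdot> b'"
    using f mor a ends square by (simp add: assoc)
  finally show "left_divides C s (f \<cdot> a')"
    using pair s f by (auto intro: greedy_pairD)
qed

end


section \<open>Normal paths for a Garside family\<close>

locale garside_category = left_cancellative_category C for C :: "('o, 'm) cat" (structure) +
  fixes S :: "'m set"
  assumes garside: "garside_family C S"
begin

abbreviation Sh :: "'m set" where "Sh \<equiv> sharp C S"

lemma S_Mor: "s \<in> S \<Longrightarrow> s \<in> Mor C"
  using garside by (auto simp: garside_family_def)

lemma sharp_Mor: "s \<in> Sh \<Longrightarrow> s \<in> Mor C"
  by (auto simp: sharp_def S_Mor invertible_Mor)

lemma mult_invertible_sharp:
  "s \<in> S \<Longrightarrow> e \<in> invertibles C \<Longrightarrow> tgt C s = src C e \<Longrightarrow> s \<cdot> e \<in> Sh"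
  by (auto simp: sharp_def)

lemma S_sharp: "s \<in> S \<Longrightarrow> s \<in> Sh"
  using mult_invertible_sharp[of s "\<one> (tgt C s)"]
  by (simp add: S_Mor right_unit ident_invertible)

lemma invertible_sharp: "e \<in> invertibles C \<Longrightarrow> e \<in> Sh"
  by (simp add: sharp_def)

lemma sharp_mult_invertible:
  assumes "s \<in> Sh" "e \<in> invertibles C" "tgt C s = src C e"
  shows "s \<cdot> e \<in> Sh"
proof (cases "s \<in> invertibles C")
  case True
  then show ?thesis using assms invertible_mult invertible_sharp by blast
next
  case False
  then obtain s' d where s': "s' \<in> S" "d \<in> invertibles C" "tgt C s' = src C d" "s = s' \<cdot> d"
    using assms by (auto simp: sharp_def)
  then have "s \<cdot> e = s' \<cdot> (d \<cdot> e)" "src C (d \<cdot> e) = tgt C s'" "d \<cdot> e \<in> invertibles C"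
    using assms by (simp_all add: assoc S_Mor invertible_Mor invertible_mult)
  then show ?thesis
    using s' mult_invertible_sharp[of s' "d \<cdot> e"] by simp
qed

text \<open>
  Divisibility by \<open>s \<cdot> e\<close> with \<open>e\<close> invertible is divisibility by \<open>s\<close>, and an invertible element
  divides everything with its source; so passing from $S$ to $S^\sharp$ adds no constraint.
\<close>

lemma greedy_pair_sharp:
  assumes "g \<in> Mor C" "h \<in> Mor C" "tgt C g = src C h"
  shows "greedy_pair C Sh g h \<longleftrightarrow> greedy_pair C S g h"
proof
  assume "greedy_pair C Sh g h"
  then show "greedy_pair C S g h"
    using S_sharp by (auto simp: greedy_pair_def)
next
  assume pair: "greedy_pair C S g h"
  show "greedy_pair C Sh g h"
    unfolding greedy_pair_def
  proof (intro ballI impI)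
    fix a f assume a: "a \<in> Sh" and f: "f \<in> Mor C" "tgt C f = src C g"
      and div: "left_divides C a (f \<cdot> g \<cdot> h)"
    show "left_divides C a (f \<cdot> g)"
    proof (cases "a \<in> invertibles C")
      case True
      then show ?thesis
        using left_divides_src[OF div] f assms by (simp add: invertible_left_divides)
    next
      case False
      then obtain s e where "s \<in> S" "e \<in> invertibles C" "tgt C s = src C e" "a = s \<cdot> e"
        using a by (auto simp: sharp_def)
      then show ?thesis
        using pair f div by (auto simp: left_divides_mult_invertible_iff S_Mor intro: greedy_pairD)
    qed
  qed
qed

lemma greedy_sharp: "greedy C Sh (x, gs) \<longleftrightarrow> greedy C S (x, gs)"
proof (induction gs arbitrary: x)
  case (Cons g gs)
  show ?case
  proof (cases gs)
    case Nil
    then show ?thesis by (simp add: greedy_Cons)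
  next
    case (Cons h hs)
    show ?thesis
      using Cons.IH greedy_pair_sharp[of g h] by (auto simp: greedy_Cons \<open>gs = h # hs\<close>)
  qed
qed simp

lemma normal_Nil [simp]: "normal C S (x, []) \<longleftrightarrow> x \<in> Ob C"
  by (simp add: normal_def)

lemma normal_Cons:
  "normal C S (x, g # gs) \<longleftrightarrow>
     g \<in> Sh \<and> src C g = x \<and> normal C S (tgt C g, gs) \<and> (gs \<noteq> [] \<longrightarrow> greedy_pair C Sh g (hd gs))"
  unfolding normal_def greedy_sharp[symmetric] by (auto simp: greedy_Cons sharp_Mor)

lemma normal_greedy: "normal C S (x, gs) \<Longrightarrow> greedy C Sh (x, gs)"
  by (simp add: normal_def greedy_sharp)

lemma normal_is_path: "normal C S w \<Longrightarrow> is_path C Sh w"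
  by (simp add: normal_def)

lemma greedy_head_divides:
  assumes "greedy C Sh (x, g # gs)" "a \<in> Sh" "left_divides C a (prod_from C x (g # gs))"
  shows "left_divides C a g"
proof -
  note P = prod_from_simps[OF greedy_is_path[OF assms(1)]]
  have "g \<in> Mor C" "src C g = x"
    using assms(1) by (auto simp: greedy_Cons)
  then show ?thesis
    using greedy_head[OF assms(1,2), of "\<one> x"] assms(3) P left_unit left_unit[OF P(1)] by auto
qed

text \<open>
  Take a normal path for \<open>e \<cdot> s\<close>. If it is empty, \<open>e \<cdot> s\<close> is an identity. Otherwise let it be
  \<open>g|gs\<close>. Since \<open>s\<close> divides $e^{-1} [g|gs]$, it divides
  $e^{-1} g$, say with quotient \<open>t\<close>. As \<open>e \<cdot> s \<cdot> t = g\<close> divides \<open>e \<cdot> s\<close> in turn, the elements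
  \<open>g\<close> and \<open>e \<cdot> s\<close> differ by an invertible right factor, and \<open>g\<close> lies in $S^\sharp$.
\<close>

lemma sharp_left_mult:
  assumes e: "e \<in> invertibles C" and s: "s \<in> Sh" and "tgt C e = src C s"
  shows "e \<cdot> s \<in> Sh"
proof -
  obtain e' where e': "e \<in> Mor C" "e' \<in> Mor C" "src C e' = tgt C e" "tgt C e' = src C e"
    "e \<cdot> e' = \<one> (src C e)" "e' \<cdot> e = \<one> (tgt C e)" using e by (rule invertibleE)
  have sM: "s \<in> Mor C" using s by (rule sharp_Mor)
  have esM: "e \<cdot> s \<in> Mor C" using e' sM assms(3) by simp
  then obtain x gs where w: "normal C S (x, gs)" "prod_from C x gs = e \<cdot> s"
    using garside unfolding garside_family_def path_value_def by (metis prod.collapse)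
  show ?thesis
  proof (cases gs)
    case Nil
    then show ?thesis
      using w ident_invertible invertible_sharp by (metis normal_Nil prod_from.simps(1))
  next
    case (Cons g hs)
    note P = prod_from_simps[OF normal_is_path[OF w(1)]]
    have x: "x = src C e"
      using P(2) w(2) e' sM assms(3) by simp
    have g: "g \<in> Sh" "g \<in> Mor C" "src C g = x" and hs: "is_path C Sh (tgt C g, hs)"
      using w(1) by (auto simp: Cons normal_Cons sharp_Mor normal_is_path)
    have "e' \<cdot> prod_from C x gs = s"
      using w(2) e' sM assms(3) by (simp add: invertible_cancel_left)
    then have "left_divides C s (e' \<cdot> prod_from C x (g # hs))"
      using sM left_divides_multI[of s "\<one> (tgt C s)"] by (simp add: right_unit Cons)
    then have "left_divides C s (e' \<cdot> g)"
      using greedy_head[OF normal_greedy, of x g hs s e'] w(1) s e' x by (simp add: Cons)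
    then obtain t where t: "t \<in> Mor C" "tgt C s = src C t" "s \<cdot> t = e' \<cdot> g"
      by (auto simp: left_divides_def)
    have "(e \<cdot> s) \<cdot> t = e \<cdot> (e' \<cdot> g)"
      using t e' sM assms(3) by (simp add: assoc)
    also have "\<dots> = g"
      using invertible_cancel_left[of e' e g] e' g x by simp
    finally have "left_divides C (e \<cdot> s) g"
      using esM t sM e' assms(3) left_divides_multI[of "e \<cdot> s" t] by simp
    moreover have "left_divides C g (e \<cdot> s)"
      using left_divides_multI[of g "prod_from C (tgt C g) hs"] g prod_from_simps[OF hs] w(2)
      by (simp add: Cons)
    ultimately have "eq_unit C g (e \<cdot> s)"
      by (intro left_divides_antisym)
    then show ?thesis
      using sharp_mult_invertible[OF g(1)] unfolding eq_unit_def by metis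
  qed
qed

text \<open>
  In the comparison loop this turns the pending factor \<open>e\<close> and the rest of the first path into a
  single normal path, to which uniqueness of the first entry applies.
\<close>

lemma normal_left_mult:
  assumes "normal C S (tgt C e, a # as)" "e \<in> invertibles C"
  shows "normal C S (src C e, e \<cdot> a # as)"
proof -
  have a: "a \<in> Sh" "a \<in> Mor C" "src C a = tgt C e" "normal C S (tgt C a, as)"
    using assms(1) by (auto simp: normal_Cons sharp_Mor)
  have "greedy_pair C Sh (e \<cdot> a) (hd as)" if "as \<noteq> []"
    using that assms a
    by (cases as) (auto simp: normal_Cons sharp_Mor invertible_Mor intro: greedy_pair_mult_left)
  then show ?thesis
    using a assms(2) by (auto simp: normal_Cons sharp_left_mult invertible_Mor)
qed

text \<open>
  Each first entry divides the common value, hence by greediness the first entry of the other path.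
\<close>

lemma normal_head_unique:
  assumes a: "normal C S (x, a # as)" and b: "normal C S (x, b # bs)"
    and eq: "prod_from C x (a # as) = prod_from C x (b # bs)"
  shows "eq_unit C a b"
proof -
  have div: "left_divides C g (prod_from C x (g # gs))" if "normal C S (x, g # gs)" for g gs
    using that prod_from_simps[OF normal_is_path, of "tgt C g" gs]
    by (auto simp: normal_Cons sharp_Mor intro!: left_divides_multI)
  have "left_divides C a b"
    using greedy_head_divides[OF normal_greedy[OF b], of a] div[OF a] a eq by (simp add: normal_Cons)
  moreover have "left_divides C b a"
    using greedy_head_divides[OF normal_greedy[OF a], of b] div[OF b] b eq by (simp add: normal_Cons)
  ultimately show ?thesis by (rule left_divides_antisym)
qed

lemma normal_idents:
  "y \<in> Ob C \<Longrightarrow> normal C S (y, replicate n (\<one> y))"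
  by (induction n) (auto simp: normal_Cons invertible_sharp ident_invertible intro: greedy_pair_ident)

lemma normal_pad:
  assumes "normal C S (x, gs)" "path_tgt C (x, gs) = y"
  shows "normal C S (x, gs @ replicate n (\<one> y))"
  using assms
proof (induction gs arbitrary: x)
  case Nil
  then show ?case by (auto simp: normal_idents)
next
  case (Cons g gs)
  have "greedy_pair C Sh g (hd (gs @ replicate n (\<one> y)))" if "gs @ replicate n (\<one> y) \<noteq> []"
  proof (cases gs)
    case Nil
    then show ?thesis
      using Cons.prems that by (auto simp: normal_Cons sharp_Mor intro: greedy_pair_ident)
  next
    case (Cons h hs)
    then show ?thesis using Cons.prems by (simp add: normal_Cons)
  qed
  then show ?case
    using Cons by (auto simp: normal_Cons)
qed

lemma path_tgt_pad:
  "is_path C A (x, gs) \<Longrightarrow> path_tgt C (x, gs) = y \<Longrightarrow>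
     path_tgt C (x, gs @ replicate n (\<one> y)) = y"
proof (induction gs arbitrary: x)
  case Nil
  then show ?case by (induction n) auto
qed auto

lemma prod_from_pad:
  "is_path C A (x, gs) \<Longrightarrow> path_tgt C (x, gs) = y \<Longrightarrow>
     prod_from C x (gs @ replicate n (\<one> y)) = prod_from C x gs"
proof (induction gs arbitrary: x)
  case Nil
  then show ?case using left_unit[of "\<one> y"] by (induction n) auto
qed auto

end


section \<open>Comparison of normal paths\<close>

lemma cost_compare_loop: "cost (compare_loop C E y e as bs) \<le> 2 * length as + 1"
proof (induction C E y e as bs rule: compare_loop.induct)
  case (1 C E y e a as b bs)
  then show ?case
    by (cases "E (b, e \<cdot>\<^bsub>C\<^esub> a)") (force simp: bind_timed_def step_def return_def)+
qed (auto simp: step_def)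

context garside_category
begin

text \<open>
  If the test succeeds with \<open>b \<cdot> e' = e \<cdot> a\<close>, then \<open>e \<cdot> a \<cdot> [as] = b \<cdot> e' \<cdot> [as]\<close>, and cancelling
  \<open>b\<close> against \<open>b \<cdot> [bs]\<close> leaves the same question for \<open>e'\<close> and the tails. If it fails,
  the values differ because equal values would force \<open>b\<close> and \<open>e \<cdot> a\<close> to differ by an
  invertible factor.
\<close>

lemma compare_loop_correct:
  assumes E: "eq_unit_test C Sh E"
    and "length as = length bs" "e \<in> invertibles C"
    and "normal C S (tgt C e, as)" "path_tgt C (tgt C e, as) = y"
    and "normal C S (src C e, bs)" "path_tgt C (src C e, bs) = y"
  shows "result (compare_loop C E y e as bs)
    \<longleftrightarrow> e \<cdot> prod_from C (tgt C e) as = prod_from C (src C e) bs"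
  using assms(2-)
proof (induction as bs arbitrary: e rule: list_induct2)
  case Nil
  then show ?case
    using right_unit[of e] by (simp add: step_def invertible_Mor)
next
  case (Cons a as b bs)
  note e = Cons.prems(1) invertible_Mor[OF Cons.prems(1)]
  have a: "a \<in> Sh" "a \<in> Mor C" "src C a = tgt C e" "normal C S (tgt C a, as)"
    using Cons.prems by (auto simp: normal_Cons sharp_Mor)
  have b: "b \<in> Sh" "b \<in> Mor C" "src C b = src C e" "normal C S (tgt C b, bs)"
    using Cons.prems by (auto simp: normal_Cons sharp_Mor)
  note P = prod_from_simps[OF normal_is_path[OF a(4)]]
  note Q = prod_from_simps[OF normal_is_path[OF b(4)]]
  have eaS: "e \<cdot> a \<in> Sh"
    using e a by (simp add: sharp_left_mult)
  have assoc_ea: "e \<cdot> prod_from C (tgt C e) (a # as) = (e \<cdot> a) \<cdot> prod_from C (tgt C a) as"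
    using e a P by (simp add: assoc)
  show ?case
  proof (cases "eq_unit C b (e \<cdot> a)")
    case True
    then obtain e' where e': "e' \<in> invertibles C" "E (b, e \<cdot> a) = Some e'" "tgt C b = src C e'"
      "b \<cdot> e' = e \<cdot> a"
      using E b eaS by (force simp: eq_unit_test_def)
    have e'M: "e' \<in> Mor C" using e' invertible_Mor by simp
    have te': "tgt C e' = tgt C a"
      using e'(3,4) e'M e a b by (metis tgt_cprod)
    have "result (compare_loop C E y e (a # as) (b # bs)) = result (compare_loop C E y e' as bs)"
      using e' by (simp add: bind_timed_def step_def)
    also have "\<dots> \<longleftrightarrow> e' \<cdot> prod_from C (tgt C a) as = prod_from C (tgt C b) bs"
      using Cons.IH[of e'] Cons.prems a b e' te' by simp
    also have "\<dots> \<longleftrightarrow> b \<cdot> (e' \<cdot> prod_from C (tgt C a) as) = b \<cdot> prod_from C (tgt C b) bs"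
      using left_cancel[of b] b e' e'M te' P Q by (metis cprod_closed src_cprod)
    also have "b \<cdot> (e' \<cdot> prod_from C (tgt C a) as) = (e \<cdot> a) \<cdot> prod_from C (tgt C a) as"
      using b e' e'M te' P by (simp add: assoc[symmetric])
    finally show ?thesis
      by (simp only: assoc_ea) simp
  next
    case False
    then have "E (b, e \<cdot> a) = None"
      using E b eaS by (auto simp: eq_unit_test_def)
    then have "\<not> result (compare_loop C E y e (a # as) (b # bs))"
      by (simp add: bind_timed_def step_def return_def)
    moreover have "e \<cdot> prod_from C (tgt C e) (a # as) \<noteq> prod_from C (src C e) (b # bs)"
    proof
      assume "e \<cdot> prod_from C (tgt C e) (a # as) = prod_from C (src C e) (b # bs)"
      then have "prod_from C (src C e) (b # bs) = prod_from C (src C e) (e \<cdot> a # as)"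
        using assoc_ea e a by simp
      then show False
        using normal_head_unique normal_left_mult Cons.prems e False by blast
    qed
    ultimately show ?thesis by simp
  qed
qed

lemma compare_normal_paths_correct:
  assumes E: "eq_unit_test C Sh E" and u: "normal C S u" and v: "normal C S v"
    and ends: "path_src u = path_src v" "path_tgt C u = path_tgt C v"
  shows "result (compare_normal_paths C E u v) \<longleftrightarrow> path_value C u = path_value C v"
proof -
  obtain x as where u': "u = (x, as)" by (cases u)
  then obtain bs where v': "v = (x, bs)" using ends by (cases v) auto
  define y where "y = path_tgt C u"
  let ?pad = "\<lambda>gs. gs @ replicate (max (length as) (length bs) - length gs) (\<one> y)"
  have pa: "is_path C Sh (x, as)" "path_tgt C (x, as) = y"
    and pb: "is_path C Sh (x, bs)" "path_tgt C (x, bs) = y"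
    using u v u' v' ends y_def by (auto simp: normal_is_path)
  have x: "x \<in> Ob C"
    using pa prod_from_simps(1,2)[OF pa(1)] src_closed by metis
  have "result (compare_loop C E y (\<one> x) (?pad as) (?pad bs))
      \<longleftrightarrow> \<one> x \<cdot> prod_from C x (?pad as) = prod_from C x (?pad bs)"
    using compare_loop_correct[OF E, of "?pad as" "?pad bs" "\<one> x" y] u v x pa pb
    by (simp add: ident_invertible u' v' normal_pad path_tgt_pad)
  also have "\<dots> \<longleftrightarrow> prod_from C x as = prod_from C x bs"
    using prod_from_simps[OF pa(1)] left_unit[of "prod_from C x as"] pa pb
    by (simp add: prod_from_pad)
  finally show ?thesis
    by (simp add: compare_normal_paths_def Let_def path_value_def u' v' y_def)
qed

end

lemma cost_compare_normal_paths:
  "cost (compare_normal_paths C E u v) \<le> 2 * max (path_length u) (path_length v) + 1"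
  unfolding compare_normal_paths_def Let_def
  by (rule order_trans[OF cost_compare_loop]) simp


section \<open>Normal decomposition\<close>

lemma round_cost: "cost (normal_decomp_round W b as) = length as"
  by (induction as arbitrary: b) (auto simp: bind_timed_def step_def return_def split: prod.splits)

lemma round_length: "length (result (normal_decomp_round W b as)) = Suc (length as)"
  by (induction as arbitrary: b) (auto simp: bind_timed_def step_def return_def split: prod.splits)

lemma normal_decomp_length: "length (result (normal_decomp_list W bs)) = length bs"
  by (induction bs) (auto simp: bind_timed_def return_def round_length)

text \<open>
  The round for the \<open>j\<close>th of \<open>p\<close> entries costs \<open>p - j\<close>, in total \<open>p (p - 1) / 2\<close>.
\<close>

lemma normal_decomp_cost: "cost (normal_decomp_list W bs) \<le> length bs ^ 2"
  by (induction bs)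
    (auto simp: bind_timed_def return_def round_cost normal_decomp_length power2_eq_square)

context garside_category
begin

lemma square_witnessE:
  assumes "square_witness C Sh W" "a \<in> Sh" "b \<in> Sh" "tgt C a = src C b"
  obtains a' b' where "W (a, b) = (a', b')" "a' \<in> Sh" "b' \<in> Sh" "tgt C a' = src C b'"
    "a \<cdot> b = a' \<cdot> b'" "greedy_pair C Sh a' b'"
  using assms by (cases "W (a, b)") (force simp: square_witness_def greedy_Cons)

text \<open>
  The first entry of the path returned for \<open>b'\<close> and \<open>as\<close> divides the value of that path, which
  is \<open>b' \<cdot> [as]\<close>; this is what the domino rule asks for.
\<close>

lemma round_correct:
  assumes W: "square_witness C Sh W"
    and "b \<in> Sh" "normal C S (tgt C b, as)"
  shows "normal C S (src C b, result (normal_decomp_round W b as))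
    \<and> prod_from C (src C b) (result (normal_decomp_round W b as)) = b \<cdot> prod_from C (tgt C b) as"
  using assms(2-)
proof (induction as arbitrary: b)
  case Nil
  then show ?case
    by (simp add: return_def normal_Cons)
next
  case (Cons a as)
  have a: "a \<in> Sh" "a \<in> Mor C" "src C a = tgt C b" "normal C S (tgt C a, as)"
    using Cons.prems by (auto simp: normal_Cons sharp_Mor)
  obtain a' b' where W': "W (b, a) = (a', b')" "a' \<in> Sh" "b' \<in> Sh" "tgt C a' = src C b'"
    "b \<cdot> a = a' \<cdot> b'" "greedy_pair C Sh a' b'"
    using square_witnessE[OF W, of b a] Cons.prems a by metis
  have M: "b \<in> Mor C" "a' \<in> Mor C" "b' \<in> Mor C"
    using W' Cons.prems sharp_Mor by auto
  have ends: "src C a' = src C b" "tgt C b' = tgt C a"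
    using W'(4,5) a M by (metis src_cprod, metis tgt_cprod)
  note P = prod_from_simps[OF normal_is_path[OF a(4)]]
  define cs where "cs = result (normal_decomp_round W b' as)"
  have res: "result (normal_decomp_round W b (a # as)) = a' # cs"
    by (simp add: bind_timed_def step_def return_def W'(1) cs_def)
  have cs: "normal C S (src C b', cs)"
    "prod_from C (src C b') cs = b' \<cdot> prod_from C (tgt C a) as"
    using Cons.IH[of b'] W' a ends by (simp_all add: cs_def)
  \<comment> \<open>If \<open>as\<close> is empty, this is just the greediness of the witness pair, as then \<open>cs = [b']\<close>.\<close>
  have "greedy_pair C Sh a' (hd cs)" if nonempty: "cs \<noteq> []"
  proof (rule domino[OF normal_greedy[OF Cons.prems(2)] W'(6,5) M W'(4)])
    obtain c ds where c: "cs = c # ds" using nonempty by (cases cs) auto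
    have "left_divides C c (prod_from C (src C b') cs)"
      using cs(1) c prod_from_simps[OF normal_is_path, of "tgt C c" ds]
      by (auto simp: normal_Cons sharp_Mor intro!: left_divides_multI)
    then show "left_divides C (hd cs) (b' \<cdot> prod_from C (tgt C a) as)"
      using cs(2) c by simp
  qed
  then have "normal C S (src C b, a' # cs)"
    using cs(1) W' ends by (simp add: normal_Cons)
  moreover have "prod_from C (src C b) (a' # cs) = b \<cdot> prod_from C (tgt C b) (a # as)"
    using cs(2) W'(4,5) M a P ends by (simp add: assoc[symmetric])
  ultimately show ?case by (simp only: res)
qed

lemma normal_decomp_list_correct:
  assumes W: "square_witness C Sh W" and "is_path C Sh (x, bs)"
  shows "normal C S (x, result (normal_decomp_list W bs))
    \<and> prod_from C x (result (normal_decomp_list W bs)) = prod_from C x bs"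
  using assms(2)
proof (induction bs arbitrary: x)
  case Nil
  then show ?case by (simp add: return_def)
next
  case (Cons b bs)
  then show ?case
    using round_correct[OF W, of b "result (normal_decomp_list W bs)"]
    by (auto simp: bind_timed_def)
qed

lemma normal_decomposition_correct:
  assumes "square_witness C Sh W" "is_path C Sh w"
  shows "normal C S (result (normal_decomposition W w))"
    and "path_value C (result (normal_decomposition W w)) = path_value C w"
    and "path_src (result (normal_decomposition W w)) = path_src w"
    and "path_tgt C (result (normal_decomposition W w)) = path_tgt C w"
proof -
  obtain x bs where w: "w = (x, bs)" by (cases w)
  have r: "result (normal_decomposition W w) = (x, result (normal_decomp_list W bs))"
    by (simp add: normal_decomposition_def bind_timed_def return_def w)
  note c = normal_decomp_list_correct[OF assms(1), of x bs]
  show n: "normal C S (result (normal_decomposition W w))"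
    unfolding r using c assms(2) by (simp add: w)
  show v: "path_value C (result (normal_decomposition W w)) = path_value C w"
    unfolding r using c assms(2) by (simp add: w path_value_def)
  show "path_src (result (normal_decomposition W w)) = path_src w"
    unfolding r by (simp add: w)
  show "path_tgt C (result (normal_decomposition W w)) = path_tgt C w"
    unfolding r using v[unfolded r] prod_from_simps(3)[OF assms(2)[unfolded w]]
      prod_from_simps(3)[OF normal_is_path[OF n[unfolded r]]]
    by (simp add: w path_value_def)
qed

lemma word_problem_I_correct:
  assumes W: "square_witness C Sh W" and E: "eq_unit_test C Sh E"
    and u: "is_path C Sh u" and v: "is_path C Sh v"
  shows "result (word_problem_I C W E u v) \<longleftrightarrow> path_value C u = path_value C v"
proof (cases "path_src u = path_src v \<and> path_tgt C u = path_tgt C v")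
  case True
  note nu = normal_decomposition_correct[OF W u] and nv = normal_decomposition_correct[OF W v]
  show ?thesis
    using True compare_normal_paths_correct[OF E nu(1) nv(1)] nu nv
    by (simp add: word_problem_I_def bind_timed_def step_def)
next
  case False
  have "src C (path_value C w) = path_src w" "tgt C (path_value C w) = path_tgt C w"
    if "is_path C Sh w" for w
    using prod_from_simps[of Sh "path_src w" "entries w"] that by (simp_all add: path_value_def)
  then have "path_value C u \<noteq> path_value C v"
    using False u v by metis
  then show ?thesis
    using False by (auto simp: word_problem_I_def bind_timed_def step_def return_def)
qed

end

text \<open>
  Two steps compare the endpoints, two decompositions cost at most \<open>l\<^sup>2\<close> each, and the comparison
  at most \<open>2 * l + 1\<close>, as decomposition preserves the length.
\<close>

lemma cost_word_problem_I:
  fixes u v :: "('o, 'm) path"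
  assumes "path_length u \<le> l" "path_length v \<le> l"
  shows "cost (word_problem_I C W E u v) \<le> 2 * l ^ 2 + 2 * l + 3"
proof -
  have decomp: "cost (normal_decomposition W w) \<le> l ^ 2" if "path_length w \<le> l" for w :: "('o, 'm) path"
    using power_mono[OF that, of 2] order_trans[OF normal_decomp_cost[of W "entries w"], of "l ^ 2"]
    by (simp add: normal_decomposition_def bind_timed_def return_def)
  have len: "path_length (result (normal_decomposition W w)) = path_length w" for w :: "('o, 'm) path"
    by (simp add: normal_decomposition_def bind_timed_def return_def normal_decomp_length)
  have "cost (compare_normal_paths C E (result (normal_decomposition W u))
      (result (normal_decomposition W v))) \<le> 2 * l + 1"
    using assms
    by (intro order_trans[OF cost_compare_normal_paths]) (simp add: len)
  then show ?thesis
    using decomp[OF assms(1)] decomp[OF assms(2)]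
    by (auto simp: word_problem_I_def bind_timed_def step_def return_def)
qed


section \<open>The two decision procedures\<close>

theorem proposition4p13:
  fixes C :: "('o, 'm) cat" and S :: "'m set"
    and W :: "'m \<times> 'm \<Rightarrow> 'm \<times> 'm" and E :: "'m \<times> 'm \<Rightarrow> 'm option"
  assumes "left_cancellative_category C"
    and "garside_family C S"
    and "square_witness C (sharp C S) W"
    and "eq_unit_test C (sharp C S) E"
  shows
    "(\<exists>T :: nat \<Rightarrow> nat. (\<lambda>l. real (T l)) \<in> O(\<lambda>l. real l) \<and>
       (\<forall>l u v. normal C S u \<and> normal C S v \<and>
          path_src u = path_src v \<and> path_tgt C u = path_tgt C v \<and>
          path_length u \<le> l \<and> path_length v \<le> l \<longrightarrow>
          (result (compare_normal_paths C E u v) \<longleftrightarrow> path_value C u = path_value C v) \<and>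
          cost (compare_normal_paths C E u v) \<le> T l)) \<and>
     (\<exists>T :: nat \<Rightarrow> nat. (\<lambda>l. real (T l)) \<in> O(\<lambda>l. (real l)\<^sup>2) \<and>
       (\<forall>l u v. is_path C (sharp C S) u \<and> is_path C (sharp C S) v \<and>
          path_length u \<le> l \<and> path_length v \<le> l \<longrightarrow>
          (result (word_problem_I C W E u v) \<longleftrightarrow> path_value C u = path_value C v) \<and>
          cost (word_problem_I C W E u v) \<le> T l))"
proof -
  interpret garside_category C S
    using assms(1,2) by (simp add: garside_category_def garside_category_axioms_def)
  have "(\<lambda>l. real (2 * l + 1)) \<in> O(\<lambda>l. real l)"
    by (intro bigoI[of _ 3] eventually_sequentiallyI[of 1]) simp
  moreover have "cost (compare_normal_paths C E u v) \<le> 2 * l + 1"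
    if "path_length u \<le> l" "path_length v \<le> l" for l u v
    using that by (intro order_trans[OF cost_compare_normal_paths]) simp
  moreover have "(\<lambda>l. real (2 * l ^ 2 + 2 * l + 3)) \<in> O(\<lambda>l. (real l)\<^sup>2)"
  proof (intro bigoI[of _ 7] eventually_sequentiallyI[of 1])
    fix l :: nat
    assume "1 \<le> l"
    then have "l \<le> l ^ 2" "1 \<le> l ^ 2"
      by (simp_all add: power2_eq_square)
    then have "2 * l ^ 2 + 2 * l + 3 \<le> 7 * l ^ 2" by linarith
    then have "real (2 * l ^ 2 + 2 * l + 3) \<le> real (7 * l ^ 2)" by (simp only: of_nat_le_iff)
    then show "norm (real (2 * l ^ 2 + 2 * l + 3)) \<le> 7 * norm ((real l)\<^sup>2)" by simp
  qed
  ultimately show ?thesis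
    using compare_normal_paths_correct[OF assms(4)] word_problem_I_correct[OF assms(3,4)]
      cost_word_problem_I[where C = C and W = W and E = E]
    by (intro conjI exI[of _ "\<lambda>l. 2 * l + 1"] exI[of _ "\<lambda>l. 2 * l ^ 2 + 2 * l + 3"]) auto
qed

end
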